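(* System $\mathsf{SKS}$ and system $\mathsf{SKSg}$ are strongly equivalent.
   Context: Structures: generated by $S ::= \mathsf f \mid \mathsf t \mid a \mid [S,\dots,S] \mid (S,\dots,S) \mid \bar S$ (non-empty lists), where $a$ ranges over atoms, $\mathsf f,\mathsf t$ are the units false and true, $[\cdot]$ is disjunction, $(\cdot)$ is conjunction, $\bar S$ is negation; the negation of an atom is again an atom. A context $S\{\ \}$ is a structure with one occurrence of a hole, not in the scope of a negation; $S\{R\}$ is the result of filling it with $R$; $S[R,T]$ abbreviates $S\{[R,T]\}$ and $S(R,T)$ abbreviates $S\{(R,T)\}$. Equivalent structures are not distinguished; equivalence is the smallest equivalence relation induced by: $[\vec R,[\vec T],\vec U]=[\vec R,\vec T,\vec U]$ and $(\vec R,(\vec T),\vec U)=(\vec R,\vec T,\vec U)$ (with $\vec R,\vec T,\vec U$ finite sequences, $\vec T$ non-empty); $[R,T]=[T,R]$, $(R,T)=(T,R)$; $(\mathsf f,\mathsf f)=\mathsf f$, $[\mathsf f,R]=R$, $[\mathsf t,\mathsf t]=\mathsf t$, $(\mathsf t,R)=R$; $\bar{\mathsf f}=\mathsf t$, $\bar{\mathsf t}=\mathsf f$, $\overline{[R,T]}=(\bar R,\bar T)$, $\overline{(R,T)}=[\bar R,\bar T]$, $\bar{\bar R}=R$; and closure: if $R=T$ then $S\{R\}=S\{T\}$ and $\bar R=\bar T$. A derivation in a system (set of inference rules) is a finite sequence of rule instances, read top-down, the conclusion of each being the premise of the next; it may consist of a single structure. Its premise is the topmost structure, its conclusion the bottommost.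 System $\mathsf{SKSg}$ has the rules (written $\frac{\text{premise}}{\text{conclusion}}$, for arbitrary structures $R,T,U$ and contexts $S\{\ \}$): $i{\downarrow}:\frac{S\{\mathsf t\}}{S[R,\bar R]}$, $i{\uparrow}:\frac{S(R,\bar R)}{S\{\mathsf f\}}$, $s:\frac{S([R,U],T)}{S[(R,T),U]}$, $w{\downarrow}:\frac{S\{\mathsf f\}}{S\{R\}}$, $w{\uparrow}:\frac{S\{R\}}{S\{\mathsf t\}}$, $c{\downarrow}:\frac{S[R,R]}{S\{R\}}$, $c{\uparrow}:\frac{S\{R\}}{S(R,R)}$. System $\mathsf{SKS}$ has the rules (for atoms $a$ and arbitrary structures $R,T,U,V$): $ai{\downarrow}:\frac{S\{\mathsf t\}}{S[a,\bar a]}$, $ai{\uparrow}:\frac{S(a,\bar a)}{S\{\mathsf f\}}$, $s:\frac{S([R,U],T)}{S[(R,T),U]}$, $m:\frac{S[(R,U),(T,V)]}{S([R,T],[U,V])}$, $aw{\downarrow}:\frac{S\{\mathsf f\}}{S\{a\}}$, $aw{\uparrow}:\frac{S\{a\}}{S\{\mathsf t\}}$, $ac{\downarrow}:\frac{S[a,a]}{S\{a\}}$, $ac{\uparrow}:\frac{S\{a\}}{S(a,a)}$. Two systems $\mathcal S,\mathcal S'$ are strongly equivalent if for every derivation in $\mathcal S$ with premise $T$ and conclusion $R$ there is a derivation in $\mathcal S'$ with premise $T$ and conclusion $R$, and vice versa. *)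

theory Defs
  imports Main
begin

text \<open>Every atom is a propositional variable or its negation, so that the negation
  of an atom is again an atom, different from it.\<close>

datatype 'v atom = Pos 'v | Neg 'v

primrec neg_atom :: "'v atom \<Rightarrow> 'v atom" where
  "neg_atom (Pos v) = Neg v"
| "neg_atom (Neg v) = Pos v"

text \<open>The lists in disjunctions and conjunctions are non-empty: the constructors take the
  first element and the remaining ones separately.\<close>

datatype 'v struct =
    Ff
  | Tt
  | Atom "'v atom"
  | Disj "'v struct" "'v struct list"
  | Conj "'v struct" "'v struct list"
  | Bar "'v struct"

text \<open>The structures $[R_1,\dots,R_n]$ and $(R_1,\dots,R_n)$ written with an ordinary list;
  below these are applied to non-empty lists only.\<close>

definition disjunction :: "'v struct list \<Rightarrow> 'v struct" where
  "disjunction Rs = Disj (hd Rs) (tl Rs)"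

definition conjunction :: "'v struct list \<Rightarrow> 'v struct" where
  "conjunction Rs = Conj (hd Rs) (tl Rs)"

text \<open>There is no constructor for negation, as the hole must not be in its scope.\<close>

datatype 'v ctxt =
    Hole
  | CDisj "'v struct list" "'v ctxt" "'v struct list"
  | CConj "'v struct list" "'v ctxt" "'v struct list"

primrec fill :: "'v ctxt \<Rightarrow> 'v struct \<Rightarrow> 'v struct" where
  "fill Hole R = R"
| "fill (CDisj Ts S Us) R = disjunction (Ts @ [fill S R] @ Us)"
| "fill (CConj Ts S Us) R = conjunction (Ts @ [fill S R] @ Us)"

text \<open>The clause \<open>neg_atom\<close> identifies the structure obtained by negating an atom with
  the atom that is its negation.\<close>

inductive struct_eq :: "'v struct \<Rightarrow> 'v struct \<Rightarrow> bool" (infix "\<approx>" 50) where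
  refl: "R \<approx> R"
| sym: "R \<approx> T \<Longrightarrow> T \<approx> R"
| trans: "R \<approx> T \<Longrightarrow> T \<approx> U \<Longrightarrow> R \<approx> U"
| disj_assoc: "Ts \<noteq> [] \<Longrightarrow> disjunction (Rs @ [disjunction Ts] @ Us) \<approx> disjunction (Rs @ Ts @ Us)"
| conj_assoc: "Ts \<noteq> [] \<Longrightarrow> conjunction (Rs @ [conjunction Ts] @ Us) \<approx> conjunction (Rs @ Ts @ Us)"
| disj_comm: "disjunction [R, T] \<approx> disjunction [T, R]"
| conj_comm: "conjunction [R, T] \<approx> conjunction [T, R]"
| conj_Ff: "conjunction [Ff, Ff] \<approx> Ff"
| disj_Ff: "disjunction [Ff, R] \<approx> R"
| disj_Tt: "disjunction [Tt, Tt] \<approx> Tt"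
| conj_Tt: "conjunction [Tt, R] \<approx> R"
| neg_Ff: "Bar Ff \<approx> Tt"
| neg_Tt: "Bar Tt \<approx> Ff"
| neg_atom: "Bar (Atom a) \<approx> Atom (neg_atom a)"
| neg_disj: "Bar (disjunction [R, T]) \<approx> conjunction [Bar R, Bar T]"
| neg_conj: "Bar (conjunction [R, T]) \<approx> disjunction [Bar R, Bar T]"
| neg_neg: "Bar (Bar R) \<approx> R"
| ctxt_closure: "R \<approx> T \<Longrightarrow> fill S R \<approx> fill S T"
| neg_closure: "R \<approx> T \<Longrightarrow> Bar R \<approx> Bar T"

text \<open>An inference rule is given by the set of its (premise, conclusion) pairs.\<close>

type_synonym 'v inference_rule = "('v struct \<times> 'v struct) set"
type_synonym 'v inference_system = "'v inference_rule set"

definition i_down :: "'v inference_rule" where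
  "i_down = {(fill S Tt, fill S (disjunction [R, Bar R])) | S R. True}"

definition i_up :: "'v inference_rule" where
  "i_up = {(fill S (conjunction [R, Bar R]), fill S Ff) | S R. True}"

definition switch :: "'v inference_rule" where
  "switch = {(fill S (conjunction [disjunction [R, U], T]),
      fill S (disjunction [conjunction [R, T], U])) | S R T U. True}"

definition w_down :: "'v inference_rule" where
  "w_down = {(fill S Ff, fill S R) | S R. True}"

definition w_up :: "'v inference_rule" where
  "w_up = {(fill S R, fill S Tt) | S R. True}"

definition c_down :: "'v inference_rule" where
  "c_down = {(fill S (disjunction [R, R]), fill S R) | S R. True}"

definition c_up :: "'v inference_rule" where
  "c_up = {(fill S R, fill S (conjunction [R, R])) | S R. True}"

definition ai_down :: "'v inference_rule" where
  "ai_down = {(fill S Tt, fill S (disjunction [Atom a, Bar (Atom a)])) | S a. True}"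

definition ai_up :: "'v inference_rule" where
  "ai_up = {(fill S (conjunction [Atom a, Bar (Atom a)]), fill S Ff) | S a. True}"

definition medial :: "'v inference_rule" where
  "medial = {(fill S (disjunction [conjunction [R, U], conjunction [T, V]]),
      fill S (conjunction [disjunction [R, T], disjunction [U, V]]))
    | S R T U V. True}"

definition aw_down :: "'v inference_rule" where
  "aw_down = {(fill S Ff, fill S (Atom a)) | S a. True}"

definition aw_up :: "'v inference_rule" where
  "aw_up = {(fill S (Atom a), fill S Tt) | S a. True}"

definition ac_down :: "'v inference_rule" where
  "ac_down = {(fill S (disjunction [Atom a, Atom a]), fill S (Atom a)) | S a. True}"

definition ac_up :: "'v inference_rule" where
  "ac_up = {(fill S (Atom a), fill S (conjunction [Atom a, Atom a])) | S a. True}"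

definition SKSg :: "'v inference_system" where
  "SKSg = {i_down, i_up, switch, w_down, w_up, c_down, c_up}"

definition SKS :: "'v inference_system" where
  "SKS = {ai_down, ai_up, switch, medial, aw_down, aw_up, ac_down, ac_up}"

text \<open>Equivalent structures are not distinguished, so premises and conclusions, both of rule
  instances and of derivations, are determined up to \<open>\<approx>\<close> only.\<close>

definition rule_instance :: "'v inference_system \<Rightarrow> 'v struct \<Rightarrow> 'v struct \<Rightarrow> bool" where
  "rule_instance \<S> P Q \<longleftrightarrow> (\<exists>\<rho>\<in>\<S>. \<exists>(P', Q')\<in>\<rho>. P \<approx> P' \<and> Q' \<approx> Q)"

text \<open>A derivation is the list of its structures from top to bottom; a one-element list is a
  derivation without rule instances.\<close>

definition derivation :: "'v inference_system \<Rightarrow> 'v struct list \<Rightarrow> bool" where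
  "derivation \<S> D \<longleftrightarrow> D \<noteq> [] \<and> successively (rule_instance \<S>) D"

definition has_premise :: "'v struct list \<Rightarrow> 'v struct \<Rightarrow> bool" where
  "has_premise D T \<longleftrightarrow> hd D \<approx> T"

definition has_conclusion :: "'v struct list \<Rightarrow> 'v struct \<Rightarrow> bool" where
  "has_conclusion D R \<longleftrightarrow> last D \<approx> R"

definition strongly_equivalent :: "'v inference_system \<Rightarrow> 'v inference_system \<Rightarrow> bool" where
  "strongly_equivalent \<S> \<S>' \<longleftrightarrow>
    (\<forall>T R.
      (\<forall>D. derivation \<S> D \<and> has_premise D T \<and> has_conclusion D R \<longrightarrow>
        (\<exists>D'. derivation \<S>' D' \<and> has_premise D' T \<and> has_conclusion D' R)) \<and>
      (\<forall>D'. derivation \<S>' D' \<and> has_premise D' T \<and> has_conclusion D' R \<longrightarrow>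
        (\<exists>D. derivation \<S> D \<and> has_premise D T \<and> has_conclusion D R)))"

end

theory Submission
  imports Defs
begin

text \<open>Both systems derive each other's rules in every context. The general rules of \<open>SKSg\<close> are
  reduced to their atomic versions by induction on the structure the rule is applied to: identity
  and cut are decomposed by the switch rule, contraction by the medial rule, and weakening by the
  unit equations, where the step from \<open>Ff\<close> to \<open>Tt\<close> weakens in an atom and weakens it out again.
  Conversely, medial is a contraction of the whole premise followed by four weakenings.\<close>

declare struct_eq.trans [trans]

abbreviation disj2 :: "'v struct \<Rightarrow> 'v struct \<Rightarrow> 'v struct" (infixr "\<^bold>\<or>" 60) where
  "R \<^bold>\<or> T \<equiv> disjunction [R, T]"

abbreviation conj2 :: "'v struct \<Rightarrow> 'v struct \<Rightarrow> 'v struct" (infixr "\<^bold>\<and>" 65) where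
  "R \<^bold>\<and> T \<equiv> conjunction [R, T]"

subsection \<open>Equivalence of structures\<close>

lemma disj2_cong:
  assumes "R \<approx> R'" and "T \<approx> T'"
  shows "R \<^bold>\<or> T \<approx> R' \<^bold>\<or> T'"
proof -
  have "R \<^bold>\<or> T \<approx> R' \<^bold>\<or> T"
    using ctxt_closure[OF assms(1), of "CDisj [] Hole [T]"] by simp
  also have "R' \<^bold>\<or> T \<approx> R' \<^bold>\<or> T'"
    using ctxt_closure[OF assms(2), of "CDisj [R'] Hole []"] by simp
  finally show ?thesis .
qed

lemma conj2_cong:
  assumes "R \<approx> R'" and "T \<approx> T'"
  shows "R \<^bold>\<and> T \<approx> R' \<^bold>\<and> T'"
proof -
  have "R \<^bold>\<and> T \<approx> R' \<^bold>\<and> T"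
    using ctxt_closure[OF assms(1), of "CConj [] Hole [T]"] by simp
  also have "R' \<^bold>\<and> T \<approx> R' \<^bold>\<and> T'"
    using ctxt_closure[OF assms(2), of "CConj [R'] Hole []"] by simp
  finally show ?thesis .
qed

lemma disj2_assoc: "(R \<^bold>\<or> T) \<^bold>\<or> U \<approx> R \<^bold>\<or> (T \<^bold>\<or> U)"
  using disj_assoc[of "[R, T]" "[]" "[U]"] disj_assoc[of "[T, U]" "[R]" "[]"]
  by (auto intro: struct_eq.trans struct_eq.sym)

lemma conj2_assoc: "(R \<^bold>\<and> T) \<^bold>\<and> U \<approx> R \<^bold>\<and> (T \<^bold>\<and> U)"
  using conj_assoc[of "[R, T]" "[]" "[U]"] conj_assoc[of "[T, U]" "[R]" "[]"]
  by (auto intro: struct_eq.trans struct_eq.sym)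

text \<open>This exchange of the two inner components gathers the copies of each component when a
  disjunction is contracted. \<open>conj2_swap\<close> does the same for cocontracting a
  conjunction.\<close>

lemma disj2_swap: "(R \<^bold>\<or> T) \<^bold>\<or> (U \<^bold>\<or> V) \<approx> (R \<^bold>\<or> U) \<^bold>\<or> (T \<^bold>\<or> V)"
proof -
  have "(R \<^bold>\<or> T) \<^bold>\<or> (U \<^bold>\<or> V) \<approx> R \<^bold>\<or> ((T \<^bold>\<or> U) \<^bold>\<or> V)"
    by (meson disj2_assoc disj2_cong struct_eq.refl struct_eq.sym struct_eq.trans)
  also have "R \<^bold>\<or> ((T \<^bold>\<or> U) \<^bold>\<or> V) \<approx> R \<^bold>\<or> ((U \<^bold>\<or> T) \<^bold>\<or> V)"
    by (intro disj2_cong struct_eq.refl disj_comm)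
  also have "R \<^bold>\<or> ((U \<^bold>\<or> T) \<^bold>\<or> V) \<approx> (R \<^bold>\<or> U) \<^bold>\<or> (T \<^bold>\<or> V)"
    by (meson disj2_assoc disj2_cong struct_eq.refl struct_eq.sym struct_eq.trans)
  finally show ?thesis .
qed

lemma conj2_swap: "(R \<^bold>\<and> T) \<^bold>\<and> (U \<^bold>\<and> V) \<approx> (R \<^bold>\<and> U) \<^bold>\<and> (T \<^bold>\<and> V)"
proof -
  have "(R \<^bold>\<and> T) \<^bold>\<and> (U \<^bold>\<and> V) \<approx> R \<^bold>\<and> ((T \<^bold>\<and> U) \<^bold>\<and> V)"
    by (meson conj2_assoc conj2_cong struct_eq.refl struct_eq.sym struct_eq.trans)
  also have "R \<^bold>\<and> ((T \<^bold>\<and> U) \<^bold>\<and> V) \<approx> R \<^bold>\<and> ((U \<^bold>\<and> T) \<^bold>\<and> V)"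
    by (intro conj2_cong struct_eq.refl conj_comm)
  also have "R \<^bold>\<and> ((U \<^bold>\<and> T) \<^bold>\<and> V) \<approx> (R \<^bold>\<and> U) \<^bold>\<and> (T \<^bold>\<and> V)"
    by (meson conj2_assoc conj2_cong struct_eq.refl struct_eq.sym struct_eq.trans)
  finally show ?thesis .
qed

text \<open>The flattening equations say nothing about \<open>[R]\<close> unless \<open>R\<close> is itself a disjunction, so
  \<open>R\<close> is first padded with a unit.\<close>

lemma disj_singleton: "disjunction [R] \<approx> R"
proof -
  have "disjunction [R] \<approx> disjunction [Ff \<^bold>\<or> R]"
    using ctxt_closure[OF struct_eq.sym[OF disj_Ff], of "CDisj [] Hole []" R] by simp
  also have "disjunction [Ff \<^bold>\<or> R] \<approx> Ff \<^bold>\<or> R"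
    using disj_assoc[of "[Ff, R]" "[]" "[]"] by simp
  also have "Ff \<^bold>\<or> R \<approx> R"
    by (rule disj_Ff)
  finally show ?thesis .
qed

lemma conj_singleton: "conjunction [R] \<approx> R"
proof -
  have "conjunction [R] \<approx> conjunction [Tt \<^bold>\<and> R]"
    using ctxt_closure[OF struct_eq.sym[OF conj_Tt], of "CConj [] Hole []" R] by simp
  also have "conjunction [Tt \<^bold>\<and> R] \<approx> Tt \<^bold>\<and> R"
    using conj_assoc[of "[Tt, R]" "[]" "[]"] by simp
  also have "Tt \<^bold>\<and> R \<approx> R"
    by (rule conj_Tt)
  finally show ?thesis .
qed

text \<open>The flattening equation read backwards, with the tail as the inner list. It reduces
  n-ary disjunctions to nested binary ones.\<close>

lemma disj_Cons: "Rs \<noteq> [] \<Longrightarrow> disjunction (R # Rs) \<approx> R \<^bold>\<or> disjunction Rs"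
  using disj_assoc[of Rs "[R]" "[]"] by (simp add: struct_eq.sym)

lemma conj_Cons: "Rs \<noteq> [] \<Longrightarrow> conjunction (R # Rs) \<approx> R \<^bold>\<and> conjunction Rs"
  using conj_assoc[of Rs "[R]" "[]"] by (simp add: struct_eq.sym)

lemma disj_Ff_right: "R \<^bold>\<or> Ff \<approx> R"
  by (rule struct_eq.trans[OF disj_comm disj_Ff])

lemma conj_Tt_right: "R \<^bold>\<and> Tt \<approx> R"
  by (rule struct_eq.trans[OF conj_comm conj_Tt])

text \<open>Up to equivalence every structure is built from units and atoms by binary connectives, since
  negations can be pushed to the atoms; hence the induction treats \<open>R\<close> and \<open>Bar R\<close> together.\<close>

lemma struct_eq_induct [case_names eq Ff Tt Atom disj conj]:
  assumes eq: "\<And>R T. R \<approx> T \<Longrightarrow> P R \<Longrightarrow> P T"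
    and Ff: "P Ff" and Tt: "P Tt" and Atom: "\<And>a. P (Atom a)"
    and disj: "\<And>R T. P R \<Longrightarrow> P T \<Longrightarrow> P (R \<^bold>\<or> T)"
    and conj: "\<And>R T. P R \<Longrightarrow> P T \<Longrightarrow> P (R \<^bold>\<and> T)"
  shows "P R"
proof -
  note eq' = eq[OF struct_eq.sym]
  let ?Q = "\<lambda>R. P R \<and> P (Bar R)"
  have Q_eq: "?Q T" if "R \<approx> T" "?Q R" for R T
    using that eq neg_closure by blast
  \<comment> \<open>By De Morgan the negated half is a conjunction of negations, so it comes from
    the hypothesis for the dual connective.\<close>
  have Q_disj2: "?Q (R \<^bold>\<or> T)" if "?Q R" "?Q T" for R T
    using that disj conj eq'[OF neg_disj] by blast
  have Q_conj2: "?Q (R \<^bold>\<and> T)" if "?Q R" "?Q T" for R T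
    using that disj conj eq'[OF neg_conj] by blast
  have Q_disj: "?Q (disjunction Rs)" if "Rs \<noteq> []" "\<And>T. T \<in> set Rs \<Longrightarrow> ?Q T" for Rs
    using that
  proof (induction Rs rule: list_nonempty_induct)
    case (single T)
    then show ?case
      using Q_eq[OF struct_eq.sym[OF disj_singleton]] by simp
  next
    case (cons T Ts)
    then have "?Q (T \<^bold>\<or> disjunction Ts)"
      by (intro Q_disj2) simp_all
    then show ?case
      by (rule Q_eq[OF struct_eq.sym[OF disj_Cons[OF cons.hyps]]])
  qed
  have Q_conj: "?Q (conjunction Rs)" if "Rs \<noteq> []" "\<And>T. T \<in> set Rs \<Longrightarrow> ?Q T" for Rs
    using that
  proof (induction Rs rule: list_nonempty_induct)
    case (single T)
    then show ?case
      using Q_eq[OF struct_eq.sym[OF conj_singleton]] by simp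
  next
    case (cons T Ts)
    then have "?Q (T \<^bold>\<and> conjunction Ts)"
      by (intro Q_conj2) simp_all
    then show ?case
      by (rule Q_eq[OF struct_eq.sym[OF conj_Cons[OF cons.hyps]]])
  qed
  have "?Q R"
  proof (induction R)
    case Ff
    show ?case using \<open>P Ff\<close> \<open>P Tt\<close> eq'[OF neg_Ff] by blast
  next
    case Tt
    show ?case using \<open>P Ff\<close> \<open>P Tt\<close> eq'[OF neg_Tt] by blast
  next
    case (Atom a)
    show ?case using \<open>\<And>a. P (Atom a)\<close> eq'[OF neg_atom] by blast
  next
    case (Disj T Ts)
    then have "?Q (disjunction (T # Ts))"
      by (intro Q_disj) auto
    then show ?case by (simp add: disjunction_def)
  next
    case (Conj T Ts)
    then have "?Q (conjunction (T # Ts))"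
      by (intro Q_conj) auto
    then show ?case by (simp add: conjunction_def)
  next
    case (Bar T)
    \<comment> \<open>The two halves of the induction hypothesis change places:
      \<open>P (Bar T)\<close> is its second half, and \<open>P (Bar (Bar T))\<close> follows from
      its first by double negation.\<close>
    then show ?case using eq'[OF neg_neg] by blast
  qed
  then show ?thesis ..
qed

subsection \<open>Derivability\<close>

text \<open>An inductive counterpart of the list derivations. The base clause is
  \<open>\<approx>\<close> rather than identity, so that equations and inferences can be chained
  freely in one calculation.\<close>

inductive derivable :: "'v inference_system \<Rightarrow> 'v struct \<Rightarrow> 'v struct \<Rightarrow> bool"
  ("_ \<turnstile> _ \<leadsto> _" [51, 51, 51] 50) for \<S> where
  eq: "P \<approx> Q \<Longrightarrow> \<S> \<turnstile> P \<leadsto> Q"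
| step: "rule_instance \<S> P Q \<Longrightarrow> \<S> \<turnstile> Q \<leadsto> R \<Longrightarrow> \<S> \<turnstile> P \<leadsto> R"

lemma rule_instance_iff:
  "rule_instance \<S> P Q \<longleftrightarrow> (\<exists>\<rho>\<in>\<S>. \<exists>P' Q'. (P', Q') \<in> \<rho> \<and> P \<approx> P' \<and> Q' \<approx> Q)"
  by (auto simp: rule_instance_def)

lemma rule_instance_cong:
  assumes "P' \<approx> P" "rule_instance \<S> P Q" "Q \<approx> Q'"
  shows "rule_instance \<S> P' Q'"
  using assms(2) struct_eq.trans[OF assms(1)] struct_eq.trans[OF _ assms(3)]
  unfolding rule_instance_iff by blast

lemma derivable_eq_trans [trans]:
  assumes "P' \<approx> P" and "\<S> \<turnstile> P \<leadsto> Q"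
  shows "\<S> \<turnstile> P' \<leadsto> Q"
  using assms(2)
proof cases
  case eq
  then show ?thesis
    by (rule derivable.eq[OF struct_eq.trans[OF assms(1)]])
next
  case (step U)
  then show ?thesis
    using rule_instance_cong[OF assms(1) _ struct_eq.refl] derivable.step by blast
qed

lemma derivable_trans [trans]: "\<S> \<turnstile> P \<leadsto> Q \<Longrightarrow> \<S> \<turnstile> Q \<leadsto> R \<Longrightarrow> \<S> \<turnstile> P \<leadsto> R"
  by (induction rule: derivable.induct) (auto intro: derivable.step derivable_eq_trans)

lemma derivable_trans_eq [trans]: "\<S> \<turnstile> P \<leadsto> Q \<Longrightarrow> Q \<approx> Q' \<Longrightarrow> \<S> \<turnstile> P \<leadsto> Q'"
  using derivable_trans derivable.eq by blast

lemma derivable_cong: "\<S> \<turnstile> P \<leadsto> Q \<Longrightarrow> P \<approx> P' \<Longrightarrow> Q \<approx> Q' \<Longrightarrow> \<S> \<turnstile> P' \<leadsto> Q'"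
  using derivable_eq_trans[OF struct_eq.sym] derivable_trans_eq by blast

lemma derivable_rule: "\<rho> \<in> \<S> \<Longrightarrow> (P, Q) \<in> \<rho> \<Longrightarrow> \<S> \<turnstile> P \<leadsto> Q"
  by (rule derivable.step[OF _ derivable.eq[OF struct_eq.refl]])
    (auto simp: rule_instance_iff intro: struct_eq.refl)

text \<open>Every rule is a set of pairs of the form \<open>fill S _\<close>. Writing the bare
  premise and conclusion with \<open>fill Hole\<close> makes them match that form directly.\<close>

lemma derivable_rule_Hole: "\<rho> \<in> \<S> \<Longrightarrow> (fill Hole P, fill Hole Q) \<in> \<rho> \<Longrightarrow> \<S> \<turnstile> P \<leadsto> Q"
  using derivable_rule by simp

lemma derivable_iff_derivation:
  "\<S> \<turnstile> T \<leadsto> R \<longleftrightarrow> (\<exists>D. derivation \<S> D \<and> has_premise D T \<and> has_conclusion D R)"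
proof
  assume "\<S> \<turnstile> T \<leadsto> R"
  then show "\<exists>D. derivation \<S> D \<and> has_premise D T \<and> has_conclusion D R"
  proof induction
    case (eq P Q)
    then have "derivation \<S> [P] \<and> has_premise [P] P \<and> has_conclusion [P] Q"
      by (simp add: derivation_def has_premise_def has_conclusion_def struct_eq.refl)
    then show ?case by blast
  next
    case (step P Q R)
    then obtain D where D: "D \<noteq> []" "successively (rule_instance \<S>) D" "hd D \<approx> Q" "last D \<approx> R"
      by (auto simp: derivation_def has_premise_def has_conclusion_def)
    \<comment> \<open>The list \<open>D\<close> starts with a structure that is only equivalent to
      \<open>Q\<close>, so the conclusion of the rule instance is first moved to
      \<open>hd D\<close>.\<close>
    have "rule_instance \<S> P (hd D)"
      by (rule rule_instance_cong[OF struct_eq.refl step.hyps(1) struct_eq.sym[OF D(3)]])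
    with D have "derivation \<S> (P # D) \<and> has_premise (P # D) P \<and> has_conclusion (P # D) R"
      by (simp add: derivation_def has_premise_def has_conclusion_def struct_eq.refl
          successively_Cons)
    then show ?case by blast
  qed
next
  \<comment> \<open>The list induction uses the actual endpoints. The equivalences with
    \<open>T\<close> and \<open>R\<close> are absorbed at the end by
    \<open>derivable_cong\<close>.\<close>
  have "\<S> \<turnstile> hd D \<leadsto> last D" if "D \<noteq> []" "successively (rule_instance \<S>) D" for D
    using that
    by (induction D rule: list_nonempty_induct)
      (auto simp: successively_Cons intro: derivable.intros struct_eq.refl)
  moreover assume "\<exists>D. derivation \<S> D \<and> has_premise D T \<and> has_conclusion D R"
  ultimately show "\<S> \<turnstile> T \<leadsto> R"
    by (auto simp: derivation_def has_premise_def has_conclusion_def intro: derivable_cong)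
qed

section \<open>Closure of derivability under contexts\<close>

primrec comp_ctxt :: "'v ctxt \<Rightarrow> 'v ctxt \<Rightarrow> 'v ctxt" where
  "comp_ctxt Hole S' = S'"
| "comp_ctxt (CDisj Ts S Us) S' = CDisj Ts (comp_ctxt S S') Us"
| "comp_ctxt (CConj Ts S Us) S' = CConj Ts (comp_ctxt S S') Us"

lemma fill_comp_ctxt: "fill (comp_ctxt S S') R = fill S (fill S' R)"
  by (induction S) simp_all

text \<open>An \<open>inference_system\<close> is an arbitrary set of relations, so deep
  applicability of its rules is a property to be stated separately.\<close>

definition ctxt_closed :: "'v inference_system \<Rightarrow> bool" where
  "ctxt_closed \<S> \<longleftrightarrow> (\<forall>\<rho>\<in>\<S>. \<forall>P Q S. (P, Q) \<in> \<rho> \<longrightarrow> (fill S P, fill S Q) \<in> \<rho>)"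

text \<open>Each rule ranges over all contexts, so a surrounding context is absorbed by composing it
  with the one of the instance.\<close>

lemma ctxt_closed_SKS: "ctxt_closed SKS"
  unfolding ctxt_closed_def SKS_def ai_down_def ai_up_def switch_def medial_def aw_down_def
    aw_up_def ac_down_def ac_up_def
  by (auto simp flip: fill_comp_ctxt) blast+

lemma ctxt_closed_SKSg: "ctxt_closed SKSg"
  unfolding ctxt_closed_def SKSg_def i_down_def i_up_def switch_def w_down_def w_up_def
    c_down_def c_up_def
  by (auto simp flip: fill_comp_ctxt) blast+

lemma rule_instance_fill:
  assumes "ctxt_closed \<S>" and "rule_instance \<S> P Q"
  shows "rule_instance \<S> (fill S P) (fill S Q)"
proof -
  obtain \<rho> P' Q' where "\<rho> \<in> \<S>" "(P', Q') \<in> \<rho>" "P \<approx> P'" "Q' \<approx> Q"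
    using assms(2) by (auto simp: rule_instance_iff)
  moreover from this have "(fill S P', fill S Q') \<in> \<rho>"
    using assms(1) unfolding ctxt_closed_def by blast
  ultimately show ?thesis
    unfolding rule_instance_iff by (blast intro: ctxt_closure)
qed

text \<open>The context is put around every structure of the derivation. From here on a rule needs
  to be derived only in the empty context.\<close>

lemma derivable_fill:
  assumes "ctxt_closed \<S>" and "\<S> \<turnstile> P \<leadsto> Q"
  shows "\<S> \<turnstile> fill S P \<leadsto> fill S Q"
  using assms(2)
  by induction (auto intro: derivable.intros ctxt_closure rule_instance_fill[OF assms(1)])

lemma derivable_disj2:
  assumes "ctxt_closed \<S>" "\<S> \<turnstile> R \<leadsto> R'" "\<S> \<turnstile> T \<leadsto> T'"
  shows "\<S> \<turnstile> R \<^bold>\<or> T \<leadsto> R' \<^bold>\<or> T'"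
proof -
  have "\<S> \<turnstile> R \<^bold>\<or> T \<leadsto> R' \<^bold>\<or> T"
    using derivable_fill[OF assms(1,2), of "CDisj [] Hole [T]"] by simp
  also have "\<S> \<turnstile> R' \<^bold>\<or> T \<leadsto> R' \<^bold>\<or> T'"
    using derivable_fill[OF assms(1,3), of "CDisj [R'] Hole []"] by simp
  finally show ?thesis .
qed

lemma derivable_conj2:
  assumes "ctxt_closed \<S>" "\<S> \<turnstile> R \<leadsto> R'" "\<S> \<turnstile> T \<leadsto> T'"
  shows "\<S> \<turnstile> R \<^bold>\<and> T \<leadsto> R' \<^bold>\<and> T'"
proof -
  have "\<S> \<turnstile> R \<^bold>\<and> T \<leadsto> R' \<^bold>\<and> T"
    using derivable_fill[OF assms(1,2), of "CConj [] Hole [T]"] by simp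
  also have "\<S> \<turnstile> R' \<^bold>\<and> T \<leadsto> R' \<^bold>\<and> T'"
    using derivable_fill[OF assms(1,3), of "CConj [R'] Hole []"] by simp
  finally show ?thesis .
qed

text \<open>Replacing each rule instance by a derivation in the other system and concatenating these
  reduces strong equivalence to translating single rules.\<close>

lemma derivable_mono:
  assumes "\<S> \<turnstile> T \<leadsto> R" and rules: "\<And>\<rho> P Q. \<rho> \<in> \<S> \<Longrightarrow> (P, Q) \<in> \<rho> \<Longrightarrow> \<S>' \<turnstile> P \<leadsto> Q"
  shows "\<S>' \<turnstile> T \<leadsto> R"
  using assms(1)
proof induction
  case (eq P Q)
  then show ?case by (rule derivable.eq)
next
  case (step P Q R)
  then obtain \<rho> P' Q' where "\<rho> \<in> \<S>" "(P', Q') \<in> \<rho>" "P \<approx> P'" "Q' \<approx> Q"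
    by (auto simp: rule_instance_iff)
  then have "\<S>' \<turnstile> P \<leadsto> Q"
    using derivable_cong[OF rules struct_eq.sym] by blast
  then show ?case
    using step.IH by (rule derivable_trans)
qed

subsection \<open>The rules of SKSg in SKS\<close>

lemma SKS_ai_down: "SKS \<turnstile> Tt \<leadsto> Atom a \<^bold>\<or> Bar (Atom a)"
  by (rule derivable_rule_Hole[of ai_down]) (unfold SKS_def ai_down_def, blast+)

lemma SKS_ai_up: "SKS \<turnstile> Atom a \<^bold>\<and> Bar (Atom a) \<leadsto> Ff"
  by (rule derivable_rule_Hole[of ai_up]) (unfold SKS_def ai_up_def, blast+)

lemma SKS_switch: "SKS \<turnstile> (R \<^bold>\<or> U) \<^bold>\<and> T \<leadsto> (R \<^bold>\<and> T) \<^bold>\<or> U"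
  by (rule derivable_rule_Hole[of switch]) (unfold SKS_def switch_def, blast+)

lemma SKS_medial: "SKS \<turnstile> (R \<^bold>\<and> U) \<^bold>\<or> (T \<^bold>\<and> V) \<leadsto> (R \<^bold>\<or> T) \<^bold>\<and> (U \<^bold>\<or> V)"
  by (rule derivable_rule_Hole[of medial]) (unfold SKS_def medial_def, blast+)

lemma SKS_aw_down: "SKS \<turnstile> Ff \<leadsto> Atom a"
  by (rule derivable_rule_Hole[of aw_down]) (unfold SKS_def aw_down_def, blast+)

lemma SKS_aw_up: "SKS \<turnstile> Atom a \<leadsto> Tt"
  by (rule derivable_rule_Hole[of aw_up]) (unfold SKS_def aw_up_def, blast+)

lemma SKS_ac_down: "SKS \<turnstile> Atom a \<^bold>\<or> Atom a \<leadsto> Atom a"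
  by (rule derivable_rule_Hole[of ac_down]) (unfold SKS_def ac_down_def, blast+)

lemma SKS_ac_up: "SKS \<turnstile> Atom a \<leadsto> Atom a \<^bold>\<and> Atom a"
  by (rule derivable_rule_Hole[of ac_up]) (unfold SKS_def ac_up_def, blast+)

lemmas SKS_disj2 = derivable_disj2[OF ctxt_closed_SKS]
lemmas SKS_conj2 = derivable_conj2[OF ctxt_closed_SKS]

section \<open>Reduction of weakening, contraction, identity and cut to their atomic forms\<close>

lemma SKS_Ff_Tt: "SKS \<turnstile> Ff \<leadsto> Tt"
  using SKS_aw_down SKS_aw_up by (rule derivable_trans)

text \<open>The unit \<open>Ff\<close> is equivalent to both the disjunction and the conjunction of
  two copies of itself, which gives one copy to weaken for each component. \<open>SKS_Ff_Tt\<close>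
  settles the case of \<open>Tt\<close>.\<close>

lemma SKS_w_down: "SKS \<turnstile> Ff \<leadsto> R"
proof (induction R rule: struct_eq_induct)
  case (eq R T)
  then show ?case by (blast intro: derivable_trans_eq)
next
  case (disj R T)
  have "Ff \<approx> Ff \<^bold>\<or> Ff" by (rule struct_eq.sym[OF disj_Ff])
  also have "SKS \<turnstile> Ff \<^bold>\<or> Ff \<leadsto> R \<^bold>\<or> T" using disj by (rule SKS_disj2)
  finally show ?case .
next
  case (conj R T)
  have "Ff \<approx> Ff \<^bold>\<and> Ff" by (rule struct_eq.sym[OF conj_Ff])
  also have "SKS \<turnstile> Ff \<^bold>\<and> Ff \<leadsto> R \<^bold>\<and> T" using conj by (rule SKS_conj2)
  finally show ?case .
qed (auto intro: SKS_Ff_Tt SKS_aw_down derivable.eq struct_eq.refl)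

lemma SKS_w_up: "SKS \<turnstile> R \<leadsto> Tt"
proof (induction R rule: struct_eq_induct)
  case (eq R T)
  then show ?case by (blast intro: derivable_eq_trans struct_eq.sym)
next
  case (disj R T)
  then have "SKS \<turnstile> R \<^bold>\<or> T \<leadsto> Tt \<^bold>\<or> Tt" by (rule SKS_disj2)
  also have "Tt \<^bold>\<or> Tt \<approx> Tt" by (rule disj_Tt)
  finally show ?case .
next
  case (conj R T)
  then have "SKS \<turnstile> R \<^bold>\<and> T \<leadsto> Tt \<^bold>\<and> Tt" by (rule SKS_conj2)
  also have "Tt \<^bold>\<and> Tt \<approx> Tt" by (rule conj_Tt)
  finally show ?case .
qed (auto intro: SKS_Ff_Tt SKS_aw_up derivable.eq struct_eq.refl)

text \<open>For a disjunction, regrouping the copies suffices. For a conjunction, medial does the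
  regrouping as an inference. In \<open>SKS_c_up\<close> the two connectives exchange these
  roles.\<close>

lemma SKS_c_down: "SKS \<turnstile> R \<^bold>\<or> R \<leadsto> R"
proof (induction R rule: struct_eq_induct)
  case (eq R T)
  then show ?case by (blast intro: derivable_cong disj2_cong)
next
  case (disj R T)
  have "(R \<^bold>\<or> T) \<^bold>\<or> (R \<^bold>\<or> T) \<approx> (R \<^bold>\<or> R) \<^bold>\<or> (T \<^bold>\<or> T)" by (rule disj2_swap)
  also have "SKS \<turnstile> (R \<^bold>\<or> R) \<^bold>\<or> (T \<^bold>\<or> T) \<leadsto> R \<^bold>\<or> T" using disj by (rule SKS_disj2)
  finally show ?case .
next
  case (conj R T)
  have "SKS \<turnstile> (R \<^bold>\<and> T) \<^bold>\<or> (R \<^bold>\<and> T) \<leadsto> (R \<^bold>\<or> R) \<^bold>\<and> (T \<^bold>\<or> T)" by (rule SKS_medial)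
  also have "SKS \<turnstile> (R \<^bold>\<or> R) \<^bold>\<and> (T \<^bold>\<or> T) \<leadsto> R \<^bold>\<and> T" using conj by (rule SKS_conj2)
  finally show ?case .
qed (auto intro: SKS_ac_down derivable.eq disj_Ff disj_Tt)

lemma SKS_c_up: "SKS \<turnstile> R \<leadsto> R \<^bold>\<and> R"
proof (induction R rule: struct_eq_induct)
  case (eq R T)
  then show ?case by (blast intro: derivable_cong conj2_cong)
next
  case (disj R T)
  then have "SKS \<turnstile> R \<^bold>\<or> T \<leadsto> (R \<^bold>\<and> R) \<^bold>\<or> (T \<^bold>\<and> T)" by (rule SKS_disj2)
  also have "SKS \<turnstile> (R \<^bold>\<and> R) \<^bold>\<or> (T \<^bold>\<and> T) \<leadsto> (R \<^bold>\<or> T) \<^bold>\<and> (R \<^bold>\<or> T)" by (rule SKS_medial)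
  finally show ?case .
next
  case (conj R T)
  then have "SKS \<turnstile> R \<^bold>\<and> T \<leadsto> (R \<^bold>\<and> R) \<^bold>\<and> (T \<^bold>\<and> T)" by (rule SKS_conj2)
  also have "(R \<^bold>\<and> R) \<^bold>\<and> (T \<^bold>\<and> T) \<approx> (R \<^bold>\<and> T) \<^bold>\<and> (R \<^bold>\<and> T)" by (rule conj2_swap)
  finally show ?case .
qed (auto intro: SKS_ac_up derivable.eq struct_eq.sym conj_Ff conj_Tt)

text \<open>The two identities are conjoined, and two switches move \<open>R'\<close> and
  \<open>T'\<close> out of the conjunction. Keeping \<open>R'\<close> and \<open>T'\<close>
  arbitrary lets the lemma serve both connectives, with the roles of a structure and its negation
  exchanged.\<close>

lemma SKS_i_down_step:
  assumes "SKS \<turnstile> Tt \<leadsto> R \<^bold>\<or> R'" and "SKS \<turnstile> Tt \<leadsto> T \<^bold>\<or> T'"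
  shows "SKS \<turnstile> Tt \<leadsto> (R \<^bold>\<and> T) \<^bold>\<or> (R' \<^bold>\<or> T')"
proof -
  have "Tt \<approx> Tt \<^bold>\<and> Tt"
    by (rule struct_eq.sym[OF conj_Tt])
  also have "SKS \<turnstile> Tt \<^bold>\<and> Tt \<leadsto> (R \<^bold>\<or> R') \<^bold>\<and> (T \<^bold>\<or> T')"
    using assms by (rule SKS_conj2)
  also have "SKS \<turnstile> (R \<^bold>\<or> R') \<^bold>\<and> (T \<^bold>\<or> T') \<leadsto> (R \<^bold>\<and> (T \<^bold>\<or> T')) \<^bold>\<or> R'"
    by (rule SKS_switch)
  \<comment> \<open>Switch takes a disjunct out of the left conjunct only, so the disjunction
    containing \<open>T'\<close> is commuted to the left.\<close>
  also have "(R \<^bold>\<and> (T \<^bold>\<or> T')) \<^bold>\<or> R' \<approx> ((T \<^bold>\<or> T') \<^bold>\<and> R) \<^bold>\<or> R'"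
    by (intro disj2_cong conj_comm struct_eq.refl)
  also have "SKS \<turnstile> ((T \<^bold>\<or> T') \<^bold>\<and> R) \<^bold>\<or> R' \<leadsto> ((T \<^bold>\<and> R) \<^bold>\<or> T') \<^bold>\<or> R'"
    by (intro SKS_disj2 SKS_switch derivable.eq struct_eq.refl)
  also have "((T \<^bold>\<and> R) \<^bold>\<or> T') \<^bold>\<or> R' \<approx> (T \<^bold>\<and> R) \<^bold>\<or> (T' \<^bold>\<or> R')"
    by (rule disj2_assoc)
  also have "(T \<^bold>\<and> R) \<^bold>\<or> (T' \<^bold>\<or> R') \<approx> (R \<^bold>\<and> T) \<^bold>\<or> (R' \<^bold>\<or> T')"
    by (intro disj2_cong conj_comm disj_comm)
  finally show ?thesis .
qed

lemma SKS_i_down: "SKS \<turnstile> Tt \<leadsto> R \<^bold>\<or> Bar R"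
proof (induction R rule: struct_eq_induct)
  case (eq R T)
  then show ?case by (blast intro: derivable_trans_eq disj2_cong neg_closure)
next
  case Ff
  have "Ff \<^bold>\<or> Bar Ff \<approx> Tt" by (rule struct_eq.trans[OF disj_Ff neg_Ff])
  then show ?case by (blast intro: derivable.eq struct_eq.sym)
next
  case Tt
  have "Tt \<^bold>\<or> Bar Tt \<approx> Tt \<^bold>\<or> Ff" by (intro disj2_cong struct_eq.refl neg_Tt)
  also have "Tt \<^bold>\<or> Ff \<approx> Tt" by (rule disj_Ff_right)
  finally show ?case by (blast intro: derivable.eq struct_eq.sym)
next
  case (Atom a)
  show ?case by (rule SKS_ai_down)
next
  case (disj R T)
  \<comment> \<open>The negation of a disjunction is a conjunction of negations, so here the
    negations must play the part of \<open>R\<close> and \<open>T\<close> in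
    \<open>SKS_i_down_step\<close>.\<close>
  then have "SKS \<turnstile> Tt \<leadsto> Bar R \<^bold>\<or> R" "SKS \<turnstile> Tt \<leadsto> Bar T \<^bold>\<or> T"
    by (blast intro: derivable_trans_eq disj_comm)+
  then have "SKS \<turnstile> Tt \<leadsto> (Bar R \<^bold>\<and> Bar T) \<^bold>\<or> (R \<^bold>\<or> T)"
    by (rule SKS_i_down_step)
  also have "(Bar R \<^bold>\<and> Bar T) \<^bold>\<or> (R \<^bold>\<or> T) \<approx> (R \<^bold>\<or> T) \<^bold>\<or> (Bar R \<^bold>\<and> Bar T)"
    by (rule disj_comm)
  also have "(R \<^bold>\<or> T) \<^bold>\<or> (Bar R \<^bold>\<and> Bar T) \<approx> (R \<^bold>\<or> T) \<^bold>\<or> Bar (R \<^bold>\<or> T)"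
    by (intro disj2_cong struct_eq.refl struct_eq.sym[OF neg_disj])
  finally show ?case .
next
  case (conj R T)
  then have "SKS \<turnstile> Tt \<leadsto> (R \<^bold>\<and> T) \<^bold>\<or> (Bar R \<^bold>\<or> Bar T)"
    by (rule SKS_i_down_step)
  also have "(R \<^bold>\<and> T) \<^bold>\<or> (Bar R \<^bold>\<or> Bar T) \<approx> (R \<^bold>\<and> T) \<^bold>\<or> Bar (R \<^bold>\<and> T)"
    by (intro disj2_cong struct_eq.refl struct_eq.sym[OF neg_conj])
  finally show ?case .
qed

text \<open>After reassociation a switch brings \<open>R'\<close> next to \<open>R\<close>. Cutting
  this pair leaves \<open>Ff\<close> beside \<open>T\<close>, which vanishes as a unit, so that
  \<open>T\<close> meets \<open>T'\<close> for the second cut.\<close>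

lemma SKS_i_up_step:
  assumes "SKS \<turnstile> R \<^bold>\<and> R' \<leadsto> Ff" and "SKS \<turnstile> T \<^bold>\<and> T' \<leadsto> Ff"
  shows "SKS \<turnstile> (R \<^bold>\<or> T) \<^bold>\<and> (R' \<^bold>\<and> T') \<leadsto> Ff"
proof -
  have "(R \<^bold>\<or> T) \<^bold>\<and> (R' \<^bold>\<and> T') \<approx> ((R \<^bold>\<or> T) \<^bold>\<and> R') \<^bold>\<and> T'"
    by (rule struct_eq.sym[OF conj2_assoc])
  also have "SKS \<turnstile> ((R \<^bold>\<or> T) \<^bold>\<and> R') \<^bold>\<and> T' \<leadsto> ((R \<^bold>\<and> R') \<^bold>\<or> T) \<^bold>\<and> T'"
    by (intro SKS_conj2 SKS_switch derivable.eq struct_eq.refl)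
  also have "SKS \<turnstile> ((R \<^bold>\<and> R') \<^bold>\<or> T) \<^bold>\<and> T' \<leadsto> (Ff \<^bold>\<or> T) \<^bold>\<and> T'"
    by (intro SKS_conj2 SKS_disj2 assms(1) derivable.eq struct_eq.refl)
  also have "(Ff \<^bold>\<or> T) \<^bold>\<and> T' \<approx> T \<^bold>\<and> T'"
    by (intro conj2_cong disj_Ff struct_eq.refl)
  also have "SKS \<turnstile> T \<^bold>\<and> T' \<leadsto> Ff"
    by (rule assms(2))
  finally show ?thesis .
qed

lemma SKS_i_up: "SKS \<turnstile> R \<^bold>\<and> Bar R \<leadsto> Ff"
proof (induction R rule: struct_eq_induct)
  case (eq R T)
  then show ?case
    by (blast intro: derivable_eq_trans conj2_cong neg_closure struct_eq.sym)
next
  case Ff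
  have "Ff \<^bold>\<and> Bar Ff \<approx> Ff \<^bold>\<and> Tt" by (intro conj2_cong struct_eq.refl neg_Ff)
  also have "Ff \<^bold>\<and> Tt \<approx> Ff" by (rule conj_Tt_right)
  finally show ?case by (rule derivable.eq)
next
  case Tt
  show ?case by (rule derivable.eq[OF struct_eq.trans[OF conj_Tt neg_Tt]])
next
  case (Atom a)
  show ?case by (rule SKS_ai_up)
next
  case (disj R T)
  have "(R \<^bold>\<or> T) \<^bold>\<and> Bar (R \<^bold>\<or> T) \<approx> (R \<^bold>\<or> T) \<^bold>\<and> (Bar R \<^bold>\<and> Bar T)"
    by (intro conj2_cong struct_eq.refl neg_disj)
  also have "SKS \<turnstile> (R \<^bold>\<or> T) \<^bold>\<and> (Bar R \<^bold>\<and> Bar T) \<leadsto> Ff"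
    using disj by (rule SKS_i_up_step)
  finally show ?case .
next
  case (conj R T)
  \<comment> \<open>Dually to identity, the disjunction required by \<open>SKS_i_up_step\<close> is
    now the one of the negations, so both cuts are commuted.\<close>
  then have "SKS \<turnstile> Bar R \<^bold>\<and> R \<leadsto> Ff" "SKS \<turnstile> Bar T \<^bold>\<and> T \<leadsto> Ff"
    by (blast intro: derivable_eq_trans conj_comm)+
  have "(R \<^bold>\<and> T) \<^bold>\<and> Bar (R \<^bold>\<and> T) \<approx> (R \<^bold>\<and> T) \<^bold>\<and> (Bar R \<^bold>\<or> Bar T)"
    by (intro conj2_cong struct_eq.refl neg_conj)
  also have "(R \<^bold>\<and> T) \<^bold>\<and> (Bar R \<^bold>\<or> Bar T) \<approx> (Bar R \<^bold>\<or> Bar T) \<^bold>\<and> (R \<^bold>\<and> T)"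
    by (rule conj_comm)
  also have "SKS \<turnstile> (Bar R \<^bold>\<or> Bar T) \<^bold>\<and> (R \<^bold>\<and> T) \<leadsto> Ff"
    using \<open>SKS \<turnstile> Bar R \<^bold>\<and> R \<leadsto> Ff\<close> \<open>SKS \<turnstile> Bar T \<^bold>\<and> T \<leadsto> Ff\<close> by (rule SKS_i_up_step)
  finally show ?case .
qed

lemma SKSg_rule_in_SKS: "\<rho> \<in> SKSg \<Longrightarrow> (P, Q) \<in> \<rho> \<Longrightarrow> SKS \<turnstile> P \<leadsto> Q"
  unfolding SKSg_def i_down_def i_up_def switch_def w_down_def w_up_def c_down_def c_up_def
  by (auto intro!: derivable_fill[OF ctxt_closed_SKS] SKS_i_down SKS_i_up SKS_switch
      SKS_w_down SKS_w_up SKS_c_down SKS_c_up)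

subsection \<open>The rules of SKS in SKSg\<close>

lemma SKSg_i_down: "SKSg \<turnstile> Tt \<leadsto> R \<^bold>\<or> Bar R"
  by (rule derivable_rule_Hole[of i_down]) (unfold SKSg_def i_down_def, blast+)

lemma SKSg_i_up: "SKSg \<turnstile> R \<^bold>\<and> Bar R \<leadsto> Ff"
  by (rule derivable_rule_Hole[of i_up]) (unfold SKSg_def i_up_def, blast+)

lemma SKSg_switch: "SKSg \<turnstile> (R \<^bold>\<or> U) \<^bold>\<and> T \<leadsto> (R \<^bold>\<and> T) \<^bold>\<or> U"
  by (rule derivable_rule_Hole[of switch]) (unfold SKSg_def switch_def, blast+)

lemma SKSg_w_down: "SKSg \<turnstile> Ff \<leadsto> R"
  by (rule derivable_rule_Hole[of w_down]) (unfold SKSg_def w_down_def, blast+)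

lemma SKSg_w_up: "SKSg \<turnstile> R \<leadsto> Tt"
  by (rule derivable_rule_Hole[of w_up]) (unfold SKSg_def w_up_def, blast+)

lemma SKSg_c_down: "SKSg \<turnstile> R \<^bold>\<or> R \<leadsto> R"
  by (rule derivable_rule_Hole[of c_down]) (unfold SKSg_def c_down_def, blast+)

lemma SKSg_c_up: "SKSg \<turnstile> R \<leadsto> R \<^bold>\<and> R"
  by (rule derivable_rule_Hole[of c_up]) (unfold SKSg_def c_up_def, blast+)

lemmas SKSg_disj2 = derivable_disj2[OF ctxt_closed_SKSg]
lemmas SKSg_conj2 = derivable_conj2[OF ctxt_closed_SKSg]

text \<open>The conjunct to be discarded is weakened to \<open>Tt\<close>, which is the unit of
  conjunction.\<close>

lemma SKSg_proj_left: "SKSg \<turnstile> R \<^bold>\<and> T \<leadsto> R"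
proof -
  have "SKSg \<turnstile> R \<^bold>\<and> T \<leadsto> R \<^bold>\<and> Tt"
    by (intro SKSg_conj2 SKSg_w_up derivable.eq struct_eq.refl)
  also have "R \<^bold>\<and> Tt \<approx> R" by (rule conj_Tt_right)
  finally show ?thesis .
qed

lemma SKSg_proj_right: "SKSg \<turnstile> R \<^bold>\<and> T \<leadsto> T"
  using conj_comm SKSg_proj_left by (rule derivable_eq_trans)

text \<open>Cocontraction supplies two copies of the premise. In the left copy the first conjunct of
  each disjunct is kept, in the right copy the second.\<close>

lemma SKSg_medial: "SKSg \<turnstile> (R \<^bold>\<and> U) \<^bold>\<or> (T \<^bold>\<and> V) \<leadsto> (R \<^bold>\<or> T) \<^bold>\<and> (U \<^bold>\<or> V)"
  by (rule derivable_trans[OF SKSg_c_up])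
    (intro SKSg_conj2 SKSg_disj2 SKSg_proj_left SKSg_proj_right)

text \<open>The atomic rules are the general ones at \<open>Atom a\<close>, and switch is common to
  both systems. Only medial needs a derivation of its own.\<close>

lemma SKS_rule_in_SKSg: "\<rho> \<in> SKS \<Longrightarrow> (P, Q) \<in> \<rho> \<Longrightarrow> SKSg \<turnstile> P \<leadsto> Q"
  unfolding SKS_def ai_down_def ai_up_def switch_def medial_def aw_down_def aw_up_def
    ac_down_def ac_up_def
  by (auto intro!: derivable_fill[OF ctxt_closed_SKSg] SKSg_i_down SKSg_i_up SKSg_switch
      SKSg_medial SKSg_w_down SKSg_w_up SKSg_c_down SKSg_c_up)

theorem theorem3p24:
  shows "strongly_equivalent (SKS :: 'v inference_system) SKSg"
proof -
  have "SKS \<turnstile> T \<leadsto> R \<longleftrightarrow> SKSg \<turnstile> T \<leadsto> R" for T R :: "'v struct"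
    using derivable_mono[OF _ SKS_rule_in_SKSg] derivable_mono[OF _ SKSg_rule_in_SKS] by iprover
  then show ?thesis
    \<comment> \<open>Unfolding \<open>derivable_iff_derivation\<close> rewrites the fact just
      proved into existence of list derivations, so both directions of strong equivalence can be
      read off.\<close>
    unfolding strongly_equivalent_def derivable_iff_derivation by iprover
qed

end
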